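(* Let $\lambda=\lambda_1\otimes\lambda_2$ be a product of finite, positive, nonzero measures on $\Omega=\Omega_1\times\Omega_2$, and let $f_\mu$ be an arbitrary element of $\mathcal{B}^2(\lambda)$. Then the interaction part $f_{\mu,\mathrm{int}}=f_\mu\ominus(f_{\mu,1}\oplus f_{\mu,2})$ is the unique orthogonal projection of $f_\mu$ on $\mathcal{B}^2_{\mathrm{int}}(\lambda)$.
   Context: Bayes space. For a finite, positive, nonzero measure $\lambda$ on a measurable space $(\Omega,\mathcal{A})$, $\mathcal{M}(\lambda)$ is the set of $\sigma$-finite positive measures $\mu$ on $(\Omega,\mathcal A)$ with the same null sets as $\lambda$; $\mu$ is identified with its $\lambda$-density $f_\mu=d\mu/d\lambda$. Write $f_\mu\propto f_\nu$ if $f_\mu=c f_\nu$ ($\lambda$-a.e.) for some $c\in(0,\infty)$. The Bayes space is $\mathcal{B}(\lambda)=\mathcal{M}(\lambda)/\!\propto$; equality of elements means $\propto$. Vector space operations: $f\oplus g\propto fg$, $\alpha\odot f\propto f^{\alpha}$, $f\ominus g=f\oplus((-1)\odot g)$; the neutral element is the constant density $1$. $\mathcal{B}^2(\lambda)=\{f\in\mathcal{B}(\lambda):\int_\Omega|\ln f|^2d\lambda<\infty\}$ is a Hilbert space with inner product $\langle f,g\rangle_{\mathcal{B}^2(\lambda)}=\frac{1}{2\lambda(\Omega)}\int_\Omega\int_\Omega \ln\{f(\omega)/f(\omega')\}\ln\{g(\omega)/g(\omega')\}\,d\lambda(\omega)\,d\lambda(\omega')$. Bivariate setting. $(\Omega_i,\mathcal{A}_i,\lambda_i)$,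 $i\in\{1,2\}$, are measurable spaces with finite, positive, nonzero measures; $\Omega=\Omega_1\times\Omega_2$, $\mathcal A=\mathcal A_1\otimes\mathcal A_2$, $\lambda=\lambda_1\otimes\lambda_2$. The independence space is $\mathcal{B}^2_{\mathrm{ind}}(\lambda)=\{\mu\in\mathcal{B}^2(\lambda):\mu=\mu_1\otimes\mu_2\text{ for some }\mu_1\in\mathcal{B}^2(\lambda_1),\mu_2\in\mathcal{B}^2(\lambda_2)\}$, and the interaction space $\mathcal{B}^2_{\mathrm{int}}(\lambda)=\{f_\mu\in\mathcal{B}^2(\lambda):\langle f_\mu,f_\nu\rangle_{\mathcal{B}^2(\lambda)}=0\ \text{for all } f_\nu\in\mathcal{B}^2_{\mathrm{ind}}(\lambda)\}$ is its orthogonal complement. Geometric margins of $f_\mu\in\mathcal{B}^2(\lambda)$: $f_{\mu,1}(\omega_1,\omega_2)\equiv f_{\mu,1}(\omega_1)\propto\exp[\frac1{\lambda_2(\Omega_2)}\int_{\Omega_2}\ln\{f_\mu(\omega_1,\omega^* )\}d\lambda_2(\omega^* )]$ and $f_{\mu,2}(\omega_1,\omega_2)\equiv f_{\mu,2}(\omega_2)\propto\exp[\frac1{\lambda_1(\Omega_1)}\int_{\Omega_1}\ln\{f_\mu(\omega^*,\omega_2)\}d\lambda_1(\omega^* )]$. *)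

theory Defs
  imports "HOL-Analysis.Analysis"
begin

section \<open>Bayes spaces\<close>

definition bayes_measures :: "'a measure \<Rightarrow> 'a measure set" where
  "bayes_measures L =
     {M. sigma_finite_measure M \<and> sets M = sets L \<and> null_sets M = null_sets L}"

definition bayes_density :: "'a measure \<Rightarrow> 'a measure \<Rightarrow> 'a \<Rightarrow> real" where
  "bayes_density L M = (\<lambda>x. enn2real (RN_deriv L M x))"

definition propto :: "'a measure \<Rightarrow> ('a \<Rightarrow> real) \<Rightarrow> ('a \<Rightarrow> real) \<Rightarrow> bool" where
  "propto L f g \<longleftrightarrow> (\<exists>c>0. AE x in L. f x = c * g x)"

definition propto_rel :: "'a measure \<Rightarrow> ('a measure \<times> 'a measure) set" where
  "propto_rel L = {(M, N). M \<in> bayes_measures L \<and> N \<in> bayes_measures L \<and>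
     propto L (bayes_density L M) (bayes_density L N)}"

definition bayes_space :: "'a measure \<Rightarrow> 'a measure set set" where
  "bayes_space L = bayes_measures L // propto_rel L"

definition bayes_class :: "'a measure \<Rightarrow> ('a \<Rightarrow> real) \<Rightarrow> 'a measure set" where
  "bayes_class L f = propto_rel L `` {density L (\<lambda>x. ennreal (f x))}"

text \<open>
  A density representing an element of the Bayes space. It is determined by the element only up
  to a positive constant and a null set; all notions below are insensitive to that choice (see
  the lemmas at the end of this theory).
\<close>

definition dens :: "'a measure \<Rightarrow> 'a measure set \<Rightarrow> 'a \<Rightarrow> real" where
  "dens L F = bayes_density L (SOME M. M \<in> F)"

definition bayes_plus :: "'a measure \<Rightarrow> 'a measure set \<Rightarrow> 'a measure set \<Rightarrow> 'a measure set" where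
  "bayes_plus L F G = bayes_class L (\<lambda>x. dens L F x * dens L G x)"

definition bayes_scale :: "'a measure \<Rightarrow> real \<Rightarrow> 'a measure set \<Rightarrow> 'a measure set" where
  "bayes_scale L a F = bayes_class L (\<lambda>x. dens L F x powr a)"

definition bayes_minus :: "'a measure \<Rightarrow> 'a measure set \<Rightarrow> 'a measure set \<Rightarrow> 'a measure set" where
  "bayes_minus L F G = bayes_plus L F (bayes_scale L (- 1) G)"

definition bayes_L2 :: "'a measure \<Rightarrow> 'a measure set set" where
  "bayes_L2 L =
     {F \<in> bayes_space L. (\<integral>\<^sup>+ x. ennreal (\<bar>ln (dens L F x)\<bar>\<^sup>2) \<partial>L) < \<infinity>}"

definition bayes_inner :: "'a measure \<Rightarrow> 'a measure set \<Rightarrow> 'a measure set \<Rightarrow> real" where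
  "bayes_inner L F G = 1 / (2 * measure L (space L)) *
     (\<integral>w'. (\<integral>w. ln (dens L F w / dens L F w') * ln (dens L G w / dens L G w') \<partial>L) \<partial>L)"


section \<open>Independence, interaction and geometric margins\<close>

text \<open>The condition on \<open>M1 \<Otimes>\<^sub>M M2\<close> says that \<open>F\<close> and the product measure are equal up to proportionality.\<close>

definition bayes_ind :: "'a measure \<Rightarrow> 'b measure \<Rightarrow> ('a \<times> 'b) measure set set" where
  "bayes_ind L1 L2 =
     {F \<in> bayes_L2 (L1 \<Otimes>\<^sub>M L2). \<exists>F1 \<in> bayes_L2 L1. \<exists>F2 \<in> bayes_L2 L2.
        \<exists>M1 \<in> F1. \<exists>M2 \<in> F2. M1 \<Otimes>\<^sub>M M2 \<in> F}"

definition bayes_int :: "'a measure \<Rightarrow> 'b measure \<Rightarrow> ('a \<times> 'b) measure set set" where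
  "bayes_int L1 L2 =
     {F \<in> bayes_L2 (L1 \<Otimes>\<^sub>M L2). \<forall>G \<in> bayes_ind L1 L2. bayes_inner (L1 \<Otimes>\<^sub>M L2) F G = 0}"

text \<open>
  For square integrable log-densities almost every section is integrable; on the exceptional
  null set of sections the integral, and hence the exponent, is 0 by convention.
\<close>

definition geo_mean1 :: "'b measure \<Rightarrow> ('a \<times> 'b \<Rightarrow> real) \<Rightarrow> 'a \<times> 'b \<Rightarrow> real" where
  "geo_mean1 L2 f = (\<lambda>(w1, w2). exp (1 / measure L2 (space L2) * (\<integral>w. ln (f (w1, w)) \<partial>L2)))"

definition geo_mean2 :: "'a measure \<Rightarrow> ('a \<times> 'b \<Rightarrow> real) \<Rightarrow> 'a \<times> 'b \<Rightarrow> real" where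
  "geo_mean2 L1 f = (\<lambda>(w1, w2). exp (1 / measure L1 (space L1) * (\<integral>w. ln (f (w, w2)) \<partial>L1)))"

definition geo_margin1 ::
  "'a measure \<Rightarrow> 'b measure \<Rightarrow> ('a \<times> 'b) measure set \<Rightarrow> ('a \<times> 'b) measure set" where
  "geo_margin1 L1 L2 F = bayes_class (L1 \<Otimes>\<^sub>M L2) (geo_mean1 L2 (dens (L1 \<Otimes>\<^sub>M L2) F))"

definition geo_margin2 ::
  "'a measure \<Rightarrow> 'b measure \<Rightarrow> ('a \<times> 'b) measure set \<Rightarrow> ('a \<times> 'b) measure set" where
  "geo_margin2 L1 L2 F = bayes_class (L1 \<Otimes>\<^sub>M L2) (geo_mean2 L1 (dens (L1 \<Otimes>\<^sub>M L2) F))"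

definition interaction_part ::
  "'a measure \<Rightarrow> 'b measure \<Rightarrow> ('a \<times> 'b) measure set \<Rightarrow> ('a \<times> 'b) measure set" where
  "interaction_part L1 L2 F = bayes_minus (L1 \<Otimes>\<^sub>M L2) F
     (bayes_plus (L1 \<Otimes>\<^sub>M L2) (geo_margin1 L1 L2 F) (geo_margin2 L1 L2 F))"

definition is_orthogonal_projection ::
  "'a measure \<Rightarrow> 'a measure set set \<Rightarrow> 'a measure set \<Rightarrow> 'a measure set \<Rightarrow> bool" where
  "is_orthogonal_projection L S F P \<longleftrightarrow>
     P \<in> S \<and> (\<forall>H \<in> S. bayes_inner L (bayes_minus L F P) H = 0)"


section \<open>Independence of the choice of representatives\<close>

lemma propto_refl: "propto L f f"
  unfolding propto_def by (intro exI[of _ 1]) simp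

lemma propto_sym: "propto L f g \<Longrightarrow> propto L g f"
  unfolding propto_def
proof (elim exE conjE)
  fix c :: real assume c: "c > 0" "AE x in L. f x = c * g x"
  show "\<exists>c>0. AE x in L. g x = c * f x"
    by (rule exI[of _ "1 / c"]) (use c in auto)
qed

lemma propto_trans: "propto L f g \<Longrightarrow> propto L g h \<Longrightarrow> propto L f h"
  unfolding propto_def
proof (elim exE conjE)
  fix c d :: real
  assume c: "c > 0" "AE x in L. f x = c * g x" and d: "d > 0" "AE x in L. g x = d * h x"
  have "AE x in L. f x = c * d * h x"
    using c(2) d(2) by eventually_elim simp
  with c d show "\<exists>c>0. AE x in L. f x = c * h x"
    by (intro exI[of _ "c * d"]) simp
qed

lemma equiv_propto_rel: "equiv (bayes_measures L) (propto_rel L)"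
  by (rule equivI)
    (auto simp: propto_rel_def refl_on_def sym_def trans_def
      intro: propto_refl propto_sym propto_trans)

lemma bayes_density_measurable [measurable]: "bayes_density L M \<in> borel_measurable L"
  unfolding bayes_density_def by measurable

lemma bayes_density:
  assumes "finite_measure L" "M \<in> bayes_measures L"
  shows "AE x in L. 0 < bayes_density L M x"
    and "density L (\<lambda>x. ennreal (bayes_density L M x)) = M"
proof -
  interpret finite_measure L by fact
  have M: "sigma_finite_measure M" "sets M = sets L" "null_sets M = null_sets L"
    using assms(2) by (auto simp: bayes_measures_def)
  have ac: "absolutely_continuous L M"
    by (simp add: absolutely_continuous_def M)
  have fin: "AE x in L. RN_deriv L M x \<noteq> \<infinity>"
    by (rule RN_deriv_finite) (use M ac in auto)
  have eq: "density L (RN_deriv L M) = M"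
    by (rule density_RN_deriv) (use M ac in auto)
  let ?Z = "{x \<in> space L. RN_deriv L M x = 0}"
  have Z: "?Z \<in> sets L" by measurable
  have "?Z \<in> null_sets (density L (RN_deriv L M))"
    by (subst null_sets_density_iff) (use Z in auto)
  hence "?Z \<in> null_sets L"
    unfolding eq M(3) .
  hence "AE x in L. RN_deriv L M x \<noteq> 0"
    using AE_not_in[of ?Z L] by (auto elim: AE_mp)
  thus "AE x in L. 0 < bayes_density L M x"
    using fin
    by eventually_elim (simp add: bayes_density_def enn2real_positive_iff less_top zero_less_iff_neq_zero)
  have "density L (\<lambda>x. ennreal (bayes_density L M x)) = density L (RN_deriv L M)"
    by (rule density_cong)
      (use fin in \<open>auto simp: bayes_density_def less_top elim!: eventually_mono\<close>)
  thus "density L (\<lambda>x. ennreal (bayes_density L M x)) = M"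
    by (simp add: eq)
qed

lemma density_in_bayes_measures:
  assumes "finite_measure L" and [measurable]: "f \<in> borel_measurable L" and "AE x in L. 0 < f x"
  shows "density L (\<lambda>x. ennreal (f x)) \<in> bayes_measures L"
    and "AE x in L. bayes_density L (density L (\<lambda>x. ennreal (f x))) x = f x"
proof -
  interpret finite_measure L by fact
  have "sigma_finite_measure (density L (\<lambda>x. ennreal (f x)))"
    by (subst sigma_finite_iff_density_finite) auto
  moreover have "null_sets (density L (\<lambda>x. ennreal (f x))) = null_sets L"
  proof (intro set_eqI iffI)
    fix A assume "A \<in> null_sets (density L (\<lambda>x. ennreal (f x)))"
    hence A: "A \<in> sets L" "AE x in L. x \<in> A \<longrightarrow> ennreal (f x) = 0"
      by (subst (asm) null_sets_density_iff; simp)+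
    have "AE x in L. x \<notin> A"
      using A(2) assms(3) by eventually_elim (auto simp: ennreal_eq_0_iff)
    thus "A \<in> null_sets L"
      using A(1) by (simp add: AE_iff_null_sets)
  next
    fix A assume A: "A \<in> null_sets L"
    have "AE x in L. x \<in> A \<longrightarrow> ennreal (f x) = 0"
      using AE_not_in[OF A] by eventually_elim simp
    thus "A \<in> null_sets (density L (\<lambda>x. ennreal (f x)))"
      using A by (subst null_sets_density_iff) auto
  qed
  ultimately show "density L (\<lambda>x. ennreal (f x)) \<in> bayes_measures L"
    by (simp add: bayes_measures_def)
  have "AE x in L. ennreal (f x) = RN_deriv L (density L (\<lambda>x. ennreal (f x))) x"
    by (rule RN_deriv_unique) auto
  thus "AE x in L. bayes_density L (density L (\<lambda>x. ennreal (f x))) x = f x"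
    using assms(3)
  proof eventually_elim
    case (elim x)
    thus ?case by (simp add: bayes_density_def flip: elim(1))
  qed
qed

lemma dens_propto:
  assumes "F \<in> bayes_space L" "M \<in> F"
  shows "propto L (dens L F) (bayes_density L M)"
proof -
  have "(SOME N. N \<in> F) \<in> F" using assms(2) by (rule someI)
  hence "((SOME N. N \<in> F), M) \<in> propto_rel L"
    using assms quotient_eq_iff[OF equiv_propto_rel] unfolding bayes_space_def by metis
  thus ?thesis by (simp add: propto_rel_def dens_def)
qed

lemma dens_measurable [measurable]: "dens L F \<in> borel_measurable L"
  unfolding dens_def by measurable

lemma dens_pos:
  assumes "finite_measure L" "F \<in> bayes_space L"
  shows "AE x in L. 0 < dens L F x"
proof -
  have "F \<noteq> {}"
    using assms(2) in_quotient_imp_non_empty[OF equiv_propto_rel] unfolding bayes_space_def by blast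
  hence "(SOME N. N \<in> F) \<in> F" by (simp add: some_in_eq)
  moreover have "F \<subseteq> bayes_measures L"
    using assms(2) in_quotient_imp_subset[OF equiv_propto_rel] unfolding bayes_space_def by blast
  ultimately show ?thesis unfolding dens_def using bayes_density(1)[OF assms(1)] by blast
qed

lemma bayes_class_eq_iff:
  assumes "finite_measure L" "f \<in> borel_measurable L" "AE x in L. 0 < f x"
    "g \<in> borel_measurable L" "AE x in L. 0 < g x"
  shows "bayes_class L f = bayes_class L g \<longleftrightarrow> propto L f g"
proof -
  note f = density_in_bayes_measures[OF assms(1-3)]
  note g = density_in_bayes_measures[OF assms(1,4,5)]
  have "propto L (bayes_density L (density L (\<lambda>x. ennreal (f x)))) f"
       "propto L (bayes_density L (density L (\<lambda>x. ennreal (g x)))) g"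
    using f(2) g(2) unfolding propto_def by (auto intro!: exI[of _ 1])
  hence "propto L (bayes_density L (density L (\<lambda>x. ennreal (f x))))
           (bayes_density L (density L (\<lambda>x. ennreal (g x)))) \<longleftrightarrow> propto L f g"
    by (meson propto_sym propto_trans)
  thus ?thesis
    unfolding bayes_class_def eq_equiv_class_iff[OF equiv_propto_rel f(1) g(1)]
    using f(1) g(1) by (simp add: propto_rel_def)
qed

lemma bayes_class_dens:
  assumes "finite_measure L" "F \<in> bayes_space L"
  shows "bayes_class L (dens L F) = F"
proof -
  have "F \<noteq> {}" and sub: "F \<subseteq> bayes_measures L"
    using assms(2) in_quotient_imp_non_empty[OF equiv_propto_rel]
      in_quotient_imp_subset[OF equiv_propto_rel] unfolding bayes_space_def by blast+
  hence M: "(SOME N. N \<in> F) \<in> F" by (simp add: some_in_eq)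
  have "density L (\<lambda>x. ennreal (dens L F x)) = (SOME N. N \<in> F)"
    unfolding dens_def by (rule bayes_density(2)[OF assms(1)]) (use M sub in blast)
  moreover obtain N where N: "N \<in> bayes_measures L" "F = propto_rel L `` {N}"
    using assms(2) unfolding bayes_space_def by (rule quotientE)
  moreover have "(N, SOME N. N \<in> F) \<in> propto_rel L"
    using M N(2) by blast
  ultimately show ?thesis
    unfolding bayes_class_def using equiv_class_eq[OF equiv_propto_rel] by metis
qed

lemma geo_mean1_propto:
  assumes "finite_measure L1" "finite_measure L2"
    and f[measurable]: "f \<in> borel_measurable (L1 \<Otimes>\<^sub>M L2)"
    and g[measurable]: "g \<in> borel_measurable (L1 \<Otimes>\<^sub>M L2)"
    and pos: "AE x in L1 \<Otimes>\<^sub>M L2. 0 < f x" "AE x in L1 \<Otimes>\<^sub>M L2. 0 < g x"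
    and int: "integrable (L1 \<Otimes>\<^sub>M L2) (\<lambda>x. ln (g x))"
    and fg: "propto (L1 \<Otimes>\<^sub>M L2) f g"
  shows "propto (L1 \<Otimes>\<^sub>M L2) (geo_mean1 L2 f) (geo_mean1 L2 g)"
proof -
  interpret L1: finite_measure L1 by fact
  interpret L2: finite_measure L2 by fact
  interpret pair_sigma_finite L1 L2 ..
  let ?k = "1 / measure L2 (space L2)"
  obtain c where c: "c > 0" "AE x in L1 \<Otimes>\<^sub>M L2. f x = c * g x"
    using fg unfolding propto_def by blast
  have "AE x in L1 \<Otimes>\<^sub>M L2. ln (f x) = ln c + ln (g x)"
    using c(2) pos(2) by eventually_elim (use c(1) in \<open>simp add: ln_mult\<close>)
  hence ae: "AE w1 in L1. AE w in L2. ln (f (w1, w)) = ln c + ln (g (w1, w))"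
    by (rule AE_pair)
  have "AE w1 in L1. integrable L2 (\<lambda>w. ln (g (w1, w)))"
    using AE_integrable_fst[of "\<lambda>x y. ln (g (x, y))"] int by (simp add: case_prod_beta')
  with ae have "AE w1 in L1. (\<integral>w. ln (f (w1, w)) \<partial>L2)
      = ln c * measure L2 (space L2) + (\<integral>w. ln (g (w1, w)) \<partial>L2)"
    using AE_space[of L1]
  proof eventually_elim
    case (elim w1)
    have [measurable]: "(\<lambda>w. f (w1, w)) \<in> borel_measurable L2" "(\<lambda>w. g (w1, w)) \<in> borel_measurable L2"
      using elim(3) by (auto intro!: measurable_Pair2[OF f] measurable_Pair2[OF g])
    have "(\<integral>w. ln (f (w1, w)) \<partial>L2) = (\<integral>w. ln c + ln (g (w1, w)) \<partial>L2)"
      by (rule integral_cong_AE) (use elim(1) in auto)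
    also have "\<dots> = ln c * measure L2 (space L2) + (\<integral>w. ln (g (w1, w)) \<partial>L2)"
      using elim(2) by (subst Bochner_Integration.integral_add) auto
    finally show ?case .
  qed
  hence *: "AE w1 in L1. exp (?k * (\<integral>w. ln (f (w1, w)) \<partial>L2))
      = exp (?k * (ln c * measure L2 (space L2))) * exp (?k * (\<integral>w. ln (g (w1, w)) \<partial>L2))"
    by eventually_elim (simp add: add_divide_distrib flip: exp_add)
  have "AE x in L1 \<Otimes>\<^sub>M L2. geo_mean1 L2 f x
      = exp (?k * (ln c * measure L2 (space L2))) * geo_mean1 L2 g x"
  proof (rule AE_pair_measure)
    have m: "geo_mean1 L2 h \<in> borel_measurable (L1 \<Otimes>\<^sub>M L2)"
      if [measurable]: "h \<in> borel_measurable (L1 \<Otimes>\<^sub>M L2)" for h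
      unfolding geo_mean1_def by measurable
    note [measurable] = m[OF f] m[OF g]
    show "{x \<in> space (L1 \<Otimes>\<^sub>M L2). geo_mean1 L2 f x
        = exp (?k * (ln c * measure L2 (space L2))) * geo_mean1 L2 g x} \<in> sets (L1 \<Otimes>\<^sub>M L2)"
      by measurable
    show "AE x in L1. AE y in L2. geo_mean1 L2 f (x, y)
        = exp (?k * (ln c * measure L2 (space L2))) * geo_mean1 L2 g (x, y)"
      using * by eventually_elim (simp add: geo_mean1_def)
  qed
  thus ?thesis unfolding propto_def by (intro exI conjI) auto
qed

lemma geo_mean2_propto:
  assumes "finite_measure L1" "finite_measure L2"
    and f[measurable]: "f \<in> borel_measurable (L1 \<Otimes>\<^sub>M L2)"
    and g[measurable]: "g \<in> borel_measurable (L1 \<Otimes>\<^sub>M L2)"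
    and pos: "AE x in L1 \<Otimes>\<^sub>M L2. 0 < f x" "AE x in L1 \<Otimes>\<^sub>M L2. 0 < g x"
    and int: "integrable (L1 \<Otimes>\<^sub>M L2) (\<lambda>x. ln (g x))"
    and fg: "propto (L1 \<Otimes>\<^sub>M L2) f g"
  shows "propto (L1 \<Otimes>\<^sub>M L2) (geo_mean2 L1 f) (geo_mean2 L1 g)"
proof -
  interpret L1: finite_measure L1 by fact
  interpret L2: finite_measure L2 by fact
  interpret P: pair_sigma_finite L1 L2 ..
  interpret Q: pair_sigma_finite L2 L1 ..
  let ?s = "\<lambda>(x :: 'b, y :: 'a). (y, x)"
  have swap: "AE x in L2 \<Otimes>\<^sub>M L1. Q (?s x)" if "AE x in L1 \<Otimes>\<^sub>M L2. Q x" for Q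
    by (rule AE_distrD[OF measurable_pair_swap'], subst P.distr_pair_swap[symmetric], rule that)
  have swap': "AE x in L1 \<Otimes>\<^sub>M L2. Q (case x of (x, y) \<Rightarrow> (y, x))"
    if "AE x in L2 \<Otimes>\<^sub>M L1. Q x" for Q
    by (rule AE_distrD[OF measurable_pair_swap'], subst Q.distr_pair_swap[symmetric], rule that)
  have "propto (L2 \<Otimes>\<^sub>M L1) (geo_mean1 L1 (f \<circ> ?s)) (geo_mean1 L1 (g \<circ> ?s))"
  proof (rule geo_mean1_propto)
    show "integrable (L2 \<Otimes>\<^sub>M L1) (\<lambda>x. ln ((g \<circ> ?s) x))"
      using P.integrable_product_swap[OF int] by (simp add: comp_def case_prod_beta')
    show "propto (L2 \<Otimes>\<^sub>M L1) (f \<circ> ?s) (g \<circ> ?s)"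
      using fg swap unfolding propto_def by fastforce
  qed (use assms swap[OF pos(1)] swap[OF pos(2)] in \<open>auto simp: comp_def\<close>)
  then obtain c where c: "c > 0"
    "AE x in L2 \<Otimes>\<^sub>M L1. geo_mean1 L1 (f \<circ> ?s) x = c * geo_mean1 L1 (g \<circ> ?s) x"
    unfolding propto_def by blast
  from swap'[OF c(2)] have "AE x in L1 \<Otimes>\<^sub>M L2. geo_mean2 L1 f x = c * geo_mean2 L1 g x"
    by eventually_elim (auto simp: geo_mean1_def geo_mean2_def)
  with c(1) show ?thesis unfolding propto_def by blast
qed

lemma nn_integral_ln_square_propto:
  assumes "finite_measure L" and [measurable]: "f \<in> borel_measurable L" "g \<in> borel_measurable L"
    and pos: "AE x in L. 0 < g x" and fg: "propto L f g"
    and fin: "(\<integral>\<^sup>+ x. ennreal (\<bar>ln (g x)\<bar>\<^sup>2) \<partial>L) < \<infinity>"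
  shows "(\<integral>\<^sup>+ x. ennreal (\<bar>ln (f x)\<bar>\<^sup>2) \<partial>L) < \<infinity>"
proof -
  interpret finite_measure L by fact
  obtain c where c: "c > 0" "AE x in L. f x = c * g x"
    using fg unfolding propto_def by blast
  have int: "integrable L (\<lambda>x. \<bar>ln (g x)\<bar>\<^sup>2)"
    by (rule integrableI_nonneg) (use fin in auto)
  have "integrable L (\<lambda>x. \<bar>ln (f x)\<bar>\<^sup>2)"
  proof (rule Bochner_Integration.integrable_bound)
    show "integrable L (\<lambda>x. 2 * (ln c)\<^sup>2 + 2 * \<bar>ln (g x)\<bar>\<^sup>2)"
      using int by auto
    show "AE x in L. norm (\<bar>ln (f x)\<bar>\<^sup>2) \<le> norm (2 * (ln c)\<^sup>2 + 2 * \<bar>ln (g x)\<bar>\<^sup>2)"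
      using c(2) pos
    proof eventually_elim
      case (elim x)
      have "(ln c + ln (g x))\<^sup>2 \<le> 2 * (ln c)\<^sup>2 + 2 * (ln (g x))\<^sup>2"
        using sum_squares_bound[of "ln c" "ln (g x)"] by (simp add: power2_sum)
      thus ?case using elim c(1) by (simp add: ln_mult)
    qed
  qed auto
  thus ?thesis by (simp add: integrable_iff_bounded)
qed

lemma bayes_inner_representatives:
  assumes "finite_measure L" "F \<in> bayes_space L" "G \<in> bayes_space L" "M \<in> F" "N \<in> G"
  shows "bayes_inner L F G = 1 / (2 * measure L (space L)) *
    (\<integral>w'. (\<integral>w. ln (bayes_density L M w / bayes_density L M w') *
                ln (bayes_density L N w / bayes_density L N w') \<partial>L) \<partial>L)"
proof -
  interpret finite_measure L by fact
  obtain c where c: "c > 0" "AE x in L. dens L F x = c * bayes_density L M x"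
    using dens_propto[OF assms(2,4)] unfolding propto_def by blast
  obtain d where d: "d > 0" "AE x in L. dens L G x = d * bayes_density L N x"
    using dens_propto[OF assms(3,5)] unfolding propto_def by blast
  have "AE w' in L.
    (\<integral>w. ln (dens L F w / dens L F w') * ln (dens L G w / dens L G w') \<partial>L) =
    (\<integral>w. ln (bayes_density L M w / bayes_density L M w') *
         ln (bayes_density L N w / bayes_density L N w') \<partial>L)"
    using c(2) d(2)
  proof eventually_elim
    case (elim w')
    show ?case
    proof (rule integral_cong_AE)
      show "AE w in L. ln (dens L F w / dens L F w') * ln (dens L G w / dens L G w') =
        ln (bayes_density L M w / bayes_density L M w') *
        ln (bayes_density L N w / bayes_density L N w')"
        using c(2) d(2) by eventually_elim (use c(1) d(1) elim in simp)
    qed auto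
  qed
  hence "(\<integral>w'. (\<integral>w. ln (dens L F w / dens L F w') * ln (dens L G w / dens L G w') \<partial>L) \<partial>L) =
    (\<integral>w'. (\<integral>w. ln (bayes_density L M w / bayes_density L M w') *
         ln (bayes_density L N w / bayes_density L N w') \<partial>L) \<partial>L)"
    by (intro integral_cong_AE) auto
  thus ?thesis by (simp add: bayes_inner_def)
qed

end

theory Submission
  imports Defs
begin

text \<open>
  Taking logarithms of densities turns the Bayes space \<open>bayes_L2 L\<close> into the space of square
  integrable functions modulo constants: \<open>log_class L u\<close> is the element with density
  \<open>exp \<circ> u\<close>, every element has this form, perturbation and powering become addition and scalar
  multiplication (\<open>bayes_plus_log_class\<close>, \<open>bayes_scale_log_class\<close>), and the inner product becomes
  the covariance \<open>\<integral>uv - (\<integral>u)(\<integral>v) / L(\<Omega>)\<close> (\<open>bayes_inner_log_class\<close>).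

  On a product these coordinates make the claim a statement about two-way decompositions of
  functions. The independence space consists of the classes of \<open>v1(x) + v2(y)\<close>
  (\<open>bayes_ind_eq\<close>), and the geometric margins of \<open>u\<close> become its averages over one
  variable. Subtract both averages from \<open>u\<close>: the integral of the remainder \<open>p\<close> over a
  section is almost everywhere constant, in either direction. By Fubini, a function whose section
  integrals are constant has covariance zero with every square integrable function of the variable
  that indexes the sections (\<open>covar_comp_fst_eq_0\<close>).
  So the class of \<open>p\<close>, which is the interaction part, lies in the interaction space
  (\<open>covar_minus_log_margins\<close>). The difference \<open>u - p\<close> is the sum of the two averages, hence lies
  in the independence space and is orthogonal to the interaction space.

  Uniqueness is the usual argument: the difference of the logarithms of two projections lies in the
  interaction space and is orthogonal to itself, and covariance zero with itself means
  constant almost everywhere, that is, zero in the Bayes space.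
\<close>

section \<open>Square integrable functions and their covariance\<close>

definition sq_int :: "'a measure \<Rightarrow> ('a \<Rightarrow> real) \<Rightarrow> bool" where
  "sq_int L u \<longleftrightarrow> u \<in> borel_measurable L \<and> integrable L (\<lambda>x. (u x)\<^sup>2)"

definition covar :: "'a measure \<Rightarrow> ('a \<Rightarrow> real) \<Rightarrow> ('a \<Rightarrow> real) \<Rightarrow> real" where
  "covar L u v = (\<integral>x. u x * v x \<partial>L) - (\<integral>x. u x \<partial>L) * (\<integral>x. v x \<partial>L) / measure L (space L)"

lemma sq_int_measurable: "sq_int L u \<Longrightarrow> u \<in> borel_measurable L"
  by (simp add: sq_int_def)

lemma sq_int_integrable_mult:
  assumes "sq_int L u" "sq_int L v"
  shows "integrable L (\<lambda>x. u x * v x)"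
proof (rule Bochner_Integration.integrable_bound)
  show "integrable L (\<lambda>x. (u x)\<^sup>2 + (v x)\<^sup>2)"
    using assms by (simp add: sq_int_def)
  show "AE x in L. norm (u x * v x) \<le> norm ((u x)\<^sup>2 + (v x)\<^sup>2)"
  proof (rule AE_I2)
    fix x
    have "2 * (\<bar>u x\<bar> * \<bar>v x\<bar>) \<le> (u x)\<^sup>2 + (v x)\<^sup>2"
      using sum_squares_bound[of "\<bar>u x\<bar>" "\<bar>v x\<bar>"] by simp
    moreover have "0 \<le> \<bar>u x\<bar> * \<bar>v x\<bar>" by simp
    ultimately show "norm (u x * v x) \<le> norm ((u x)\<^sup>2 + (v x)\<^sup>2)"
      by (simp only: real_norm_def abs_mult)
  qed
qed (use assms in \<open>auto simp: sq_int_def\<close>)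

lemma sq_int_cmult: "sq_int L u \<Longrightarrow> sq_int L (\<lambda>x. a * u x)"
  by (auto simp: sq_int_def power_mult_distrib)

lemma sq_int_add:
  assumes "sq_int L u" "sq_int L v"
  shows "sq_int L (\<lambda>x. u x + v x)"
  using assms sq_int_integrable_mult[OF assms]
  by (auto simp: sq_int_def power2_sum mult.assoc)

lemma sq_int_diff:
  assumes "sq_int L u" "sq_int L v"
  shows "sq_int L (\<lambda>x. u x - v x)"
  using sq_int_add[OF assms(1) sq_int_cmult[OF assms(2), of "-1"]] by simp

lemma (in finite_measure) sq_int_integrable: "sq_int M u \<Longrightarrow> integrable M u"
  unfolding sq_int_def by (auto intro: square_integrable_imp_integrable)

lemma covar_commute: "covar L u v = covar L v u"
  by (simp add: covar_def mult.commute)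

lemma (in finite_measure) covar_diff_left:
  assumes "sq_int M u" "sq_int M v" "sq_int M w"
  shows "covar M (\<lambda>x. u x - v x) w = covar M u w - covar M v w"
proof -
  have "(\<integral>x. (u x - v x) * w x \<partial>M) = (\<integral>x. u x * w x \<partial>M) - (\<integral>x. v x * w x \<partial>M)"
    unfolding left_diff_distrib
    by (intro Bochner_Integration.integral_diff sq_int_integrable_mult assms)
  moreover have "(\<integral>x. u x - v x \<partial>M) = (\<integral>x. u x \<partial>M) - (\<integral>x. v x \<partial>M)"
    using sq_int_integrable assms by simp
  ultimately show ?thesis
    by (simp add: covar_def left_diff_distrib diff_divide_distrib)
qed

lemma (in finite_measure) covar_add_right:
  assumes "sq_int M u" "sq_int M v" "sq_int M w"
  shows "covar M w (\<lambda>x. u x + v x) = covar M w u + covar M w v"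
proof -
  have "(\<integral>x. w x * (u x + v x) \<partial>M) = (\<integral>x. w x * u x \<partial>M) + (\<integral>x. w x * v x \<partial>M)"
    unfolding distrib_left
    by (intro Bochner_Integration.integral_add sq_int_integrable_mult assms)
  moreover have "(\<integral>x. u x + v x \<partial>M) = (\<integral>x. u x \<partial>M) + (\<integral>x. v x \<partial>M)"
    using sq_int_integrable assms by simp
  ultimately show ?thesis
    by (simp add: covar_def distrib_left add_divide_distrib)
qed

text \<open>
  The covariance of a function with itself is its squared distance to its mean. This identity
  yields both the definiteness of the inner product modulo constants and the Jensen inequality
  for the square of a mean.
\<close>

lemma (in finite_measure) integral_square_deviation:
  assumes "sq_int M u" "measure M (space M) > 0"
  shows "(\<integral>x. (u x - (\<integral>y. u y \<partial>M) / measure M (space M))\<^sup>2 \<partial>M) = covar M u u"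
proof -
  let ?I = "\<integral>y. u y \<partial>M" and ?m = "measure M (space M)"
  have "(\<integral>x. (u x - ?I / ?m)\<^sup>2 \<partial>M) = (\<integral>x. (u x)\<^sup>2 - 2 * (?I / ?m) * u x + (?I / ?m)\<^sup>2 \<partial>M)"
    by (intro Bochner_Integration.integral_cong) (auto simp: power2_diff)
  also have "\<dots> = (\<integral>x. (u x)\<^sup>2 \<partial>M) - 2 * (?I / ?m) * ?I + (?I / ?m)\<^sup>2 * ?m"
    using assms sq_int_integrable[OF assms(1)] by (simp add: sq_int_def)
  also have "\<dots> = covar M u u"
    using assms(2) by (simp add: covar_def power2_eq_square field_simps)
  finally show ?thesis .
qed

lemma (in finite_measure) covar_self_eq_0_imp_AE_const:
  assumes "sq_int M u" "measure M (space M) > 0" "covar M u u = 0"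
  shows "\<exists>k. AE x in M. u x = k"
proof -
  define k where "k = (\<integral>y. u y \<partial>M) / measure M (space M)"
  have "sq_int M (\<lambda>x. u x - k)"
    by (rule sq_int_diff[OF assms(1)]) (simp add: sq_int_def)
  hence "AE x in M. (u x - k)\<^sup>2 = 0"
    using integral_square_deviation[OF assms(1,2)] assms(3)
    by (subst integral_nonneg_eq_0_iff_AE[symmetric]) (auto simp: sq_int_def k_def)
  thus ?thesis by (intro exI[of _ k]) simp
qed

lemma (in finite_measure) square_integral_le:
  assumes "sq_int M u" "measure M (space M) > 0"
  shows "(1 / measure M (space M) * (\<integral>x. u x \<partial>M))\<^sup>2
    \<le> 1 / measure M (space M) * (\<integral>x. (u x)\<^sup>2 \<partial>M)"
proof -
  have "0 \<le> covar M u u"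
    unfolding integral_square_deviation[OF assms, symmetric] by simp
  thus ?thesis
    using assms(2) by (simp add: covar_def power2_eq_square field_simps)
qed

section \<open>Logarithmic coordinates on the Bayes space\<close>

definition log_class :: "'a measure \<Rightarrow> ('a \<Rightarrow> real) \<Rightarrow> 'a measure set" where
  "log_class L u = bayes_class L (\<lambda>x. exp (u x))"

context finite_measure
begin

text \<open>
  A constant added to the logarithm is a factor of the density, so it does not change the class.
\<close>

lemma log_class_cong:
  assumes "u \<in> borel_measurable M" "v \<in> borel_measurable M" "AE x in M. u x = k + v x"
  shows "log_class M u = log_class M v"
proof -
  have "propto M (\<lambda>x. exp (u x)) (\<lambda>x. exp (v x))"
    unfolding propto_def
    by (rule exI[of _ "exp k"]) (use assms(3) in \<open>auto simp: exp_add\<close>)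
  thus ?thesis
    unfolding log_class_def using assms(1,2)
    by (subst bayes_class_eq_iff) (auto intro: finite_measure_axioms)
qed

lemma exp_density:
  assumes "u \<in> borel_measurable M"
  shows "density M (\<lambda>x. ennreal (exp (u x))) \<in> bayes_measures M"
    and "AE x in M. bayes_density M (density M (\<lambda>x. ennreal (exp (u x)))) x = exp (u x)"
    and "density M (\<lambda>x. ennreal (exp (u x))) \<in> log_class M u"
    and "log_class M u \<in> bayes_space M"
proof -
  show *: "density M (\<lambda>x. ennreal (exp (u x))) \<in> bayes_measures M"
    "AE x in M. bayes_density M (density M (\<lambda>x. ennreal (exp (u x)))) x = exp (u x)"
    by (rule density_in_bayes_measures; use assms in \<open>auto intro: finite_measure_axioms\<close>)+
  show "density M (\<lambda>x. ennreal (exp (u x))) \<in> log_class M u"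
    unfolding log_class_def bayes_class_def
    using equiv_class_self[OF equiv_propto_rel *(1)] .
  show "log_class M u \<in> bayes_space M"
    unfolding log_class_def bayes_class_def bayes_space_def
    by (rule quotientI) (rule *(1))
qed

lemma dens_log_class:
  assumes "u \<in> borel_measurable M"
  shows "propto M (dens M (log_class M u)) (\<lambda>x. exp (u x))"
proof (rule propto_trans[OF dens_propto[OF exp_density(4,3)[OF assms]]])
  show "propto M (bayes_density M (density M (\<lambda>x. ennreal (exp (u x))))) (\<lambda>x. exp (u x))"
    using exp_density(2)[OF assms] unfolding propto_def by (intro exI[of _ 1]) simp
qed

lemma log_class_in_bayes_L2:
  assumes "sq_int M u"
  shows "log_class M u \<in> bayes_L2 M"
proof -
  have u: "u \<in> borel_measurable M" using assms by (simp add: sq_int_def)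
  have "(\<integral>\<^sup>+ x. ennreal (\<bar>ln (exp (u x))\<bar>\<^sup>2) \<partial>M) < \<infinity>"
    using assms by (simp add: sq_int_def integrable_iff_bounded)
  from nn_integral_ln_square_propto[OF finite_measure_axioms dens_measurable _ _
      dens_log_class[OF u] this]
  have "(\<integral>\<^sup>+ x. ennreal (\<bar>ln (dens M (log_class M u) x)\<bar>\<^sup>2) \<partial>M) < \<infinity>"
    using u by simp
  thus ?thesis using exp_density(4)[OF u] by (simp add: bayes_L2_def)
qed

text \<open>
  Stated for every representing measure, and not only for the class: membership in the
  independence space asks for a product of representing measures.
\<close>

lemma bayes_L2_measure_eq_exp_density:
  assumes "F \<in> bayes_L2 M" "N \<in> F"
  shows "\<exists>u. sq_int M u \<and> N = density M (\<lambda>x. ennreal (exp (u x)))"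
proof -
  have F: "F \<in> bayes_space M" and fin: "(\<integral>\<^sup>+ x. ennreal (\<bar>ln (dens M F x)\<bar>\<^sup>2) \<partial>M) < \<infinity>"
    using assms(1) by (auto simp: bayes_L2_def)
  have N: "N \<in> bayes_measures M"
    using F assms(2) in_quotient_imp_subset[OF equiv_propto_rel] unfolding bayes_space_def by blast
  let ?u = "\<lambda>x. ln (bayes_density M N x)"
  note pos = bayes_density(1)[OF finite_measure_axioms N]
  have "propto M (bayes_density M N) (dens M F)"
    by (rule propto_sym[OF dens_propto[OF F assms(2)]])
  hence "(\<integral>\<^sup>+ x. ennreal (\<bar>?u x\<bar>\<^sup>2) \<partial>M) < \<infinity>"
    by (rule nn_integral_ln_square_propto[OF finite_measure_axioms bayes_density_measurable
          dens_measurable dens_pos[OF finite_measure_axioms F] _ fin])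
  hence "sq_int M ?u"
    by (simp add: sq_int_def integrable_iff_bounded)
  moreover have "density M (\<lambda>x. ennreal (exp (?u x))) = density M (\<lambda>x. ennreal (bayes_density M N x))"
    by (rule density_cong) (use pos in \<open>auto elim!: eventually_mono\<close>)
  ultimately show ?thesis
    using bayes_density(2)[OF finite_measure_axioms N] by (intro exI[of _ ?u]) simp
qed

lemma eq_log_class:
  assumes "F \<in> bayes_space M" "density M (\<lambda>x. ennreal (exp (u x))) \<in> F"
  shows "F = log_class M u"
proof -
  obtain N where "N \<in> bayes_measures M" "F = propto_rel M `` {N}"
    using assms(1) unfolding bayes_space_def by (rule quotientE)
  with assms(2) show ?thesis
    unfolding log_class_def bayes_class_def using equiv_class_eq[OF equiv_propto_rel] by blast
qed

lemma bayes_L2_eq_log_class: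
  assumes "F \<in> bayes_L2 M"
  obtains u where "sq_int M u" "F = log_class M u"
proof -
  have F: "F \<in> bayes_space M" using assms by (simp add: bayes_L2_def)
  then obtain N where "N \<in> F"
    using in_quotient_imp_non_empty[OF equiv_propto_rel] unfolding bayes_space_def by blast
  with that show ?thesis
    using bayes_L2_measure_eq_exp_density[OF assms] eq_log_class[OF F] by blast
qed

lemma bayes_plus_log_class:
  assumes [measurable]: "u \<in> borel_measurable M" "v \<in> borel_measurable M"
  shows "bayes_plus M (log_class M u) (log_class M v) = log_class M (\<lambda>x. u x + v x)"
proof -
  obtain c where c: "c > 0" "AE x in M. dens M (log_class M u) x = c * exp (u x)"
    using dens_log_class[OF assms(1)] unfolding propto_def by blast
  obtain d where d: "d > 0" "AE x in M. dens M (log_class M v) x = d * exp (v x)"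
    using dens_log_class[OF assms(2)] unfolding propto_def by blast
  have *: "AE x in M. dens M (log_class M u) x * dens M (log_class M v) x
      = (c * d) * exp (u x + v x)"
    using c(2) d(2) by eventually_elim (simp add: exp_add)
  hence "propto M (\<lambda>x. dens M (log_class M u) x * dens M (log_class M v) x) (\<lambda>x. exp (u x + v x))"
    unfolding propto_def using c(1) d(1) by (intro exI[of _ "c * d"]) simp
  moreover have "AE x in M. 0 < dens M (log_class M u) x * dens M (log_class M v) x"
    using * by eventually_elim (use c(1) d(1) in simp)
  ultimately show ?thesis
    unfolding bayes_plus_def log_class_def[of _ "\<lambda>x. u x + v x"]
    by (subst bayes_class_eq_iff) (auto intro: finite_measure_axioms)
qed

lemma bayes_scale_log_class:
  assumes [measurable]: "u \<in> borel_measurable M"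
  shows "bayes_scale M a (log_class M u) = log_class M (\<lambda>x. a * u x)"
proof -
  obtain c where c: "c > 0" "AE x in M. dens M (log_class M u) x = c * exp (u x)"
    using dens_log_class[OF assms(1)] unfolding propto_def by blast
  have *: "AE x in M. dens M (log_class M u) x powr a = (c powr a) * exp (a * u x)"
    using c(2)
    by eventually_elim (use c(1) in \<open>simp add: powr_mult exp_powr_real mult.commute\<close>)
  hence "propto M (\<lambda>x. dens M (log_class M u) x powr a) (\<lambda>x. exp (a * u x))"
    unfolding propto_def using c(1) by (intro exI[of _ "c powr a"]) simp
  moreover have "AE x in M. 0 < dens M (log_class M u) x powr a"
    using * by eventually_elim (use c(1) in simp)
  ultimately show ?thesis
    unfolding bayes_scale_def log_class_def[of _ "\<lambda>x. a * u x"]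
    by (subst bayes_class_eq_iff) (auto intro: finite_measure_axioms)
qed

lemma bayes_minus_log_class:
  assumes [measurable]: "u \<in> borel_measurable M" "v \<in> borel_measurable M"
  shows "bayes_minus M (log_class M u) (log_class M v) = log_class M (\<lambda>x. u x - v x)"
  by (simp add: bayes_minus_def bayes_scale_log_class bayes_plus_log_class)

text \<open>
  Expanding \<open>(u(w) - u(w')) (v(w) - v(w'))\<close> and integrating over both variables produces every term
  of the covariance twice, multiplied by the total mass; the factor \<open>1 / (2 L(\<Omega>))\<close> in the inner
  product compensates for this.
\<close>

lemma bayes_inner_log_class:
  assumes u: "sq_int M u" and v: "sq_int M v" and m: "measure M (space M) > 0"
  shows "bayes_inner M (log_class M u) (log_class M v) = covar M u v"
proof -
  have [measurable]: "u \<in> borel_measurable M" "v \<in> borel_measurable M"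
    using u v by (auto simp: sq_int_def)
  let ?m = "measure M (space M)" and ?U = "\<integral>x. u x \<partial>M" and ?V = "\<integral>x. v x \<partial>M"
    and ?UV = "\<integral>x. u x * v x \<partial>M"
    and ?f = "bayes_density M (density M (\<lambda>x. ennreal (exp (u x))))"
    and ?g = "bayes_density M (density M (\<lambda>x. ennreal (exp (v x))))"
  have int: "integrable M u" "integrable M v" "integrable M (\<lambda>x. u x * v x)"
    using u v by (auto intro: sq_int_integrable sq_int_integrable_mult)
  have f: "AE x in M. ?f x = exp (u x)" and g: "AE x in M. ?g x = exp (v x)"
    by (rule exp_density; simp)+
  have "AE w' in M. (\<integral>w. ln (?f w / ?f w') * ln (?g w / ?g w') \<partial>M)
      = ?UV - v w' * ?U - u w' * ?V + u w' * v w' * ?m"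
    using f g
  proof eventually_elim
    case (elim w')
    have "(\<integral>w. ln (?f w / ?f w') * ln (?g w / ?g w') \<partial>M) = (\<integral>w. (u w - u w') * (v w - v w') \<partial>M)"
    proof (rule integral_cong_AE)
      show "AE w in M. ln (?f w / ?f w') * ln (?g w / ?g w') = (u w - u w') * (v w - v w')"
        using f g by eventually_elim (use elim in \<open>simp flip: exp_diff\<close>)
    qed measurable
    also have "\<dots> = (\<integral>w. u w * v w - v w' * u w - u w' * v w + u w' * v w' \<partial>M)"
      by (intro Bochner_Integration.integral_cong) (auto simp: algebra_simps)
    also have "\<dots> = ?UV - v w' * ?U - u w' * ?V + u w' * v w' * ?m"
      using int by simp
    finally show ?case .
  qed
  hence "(\<integral>w'. (\<integral>w. ln (?f w / ?f w') * ln (?g w / ?g w') \<partial>M) \<partial>M)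
      = (\<integral>w'. ?UV - v w' * ?U - u w' * ?V + u w' * v w' * ?m \<partial>M)"
    by (intro integral_cong_AE) auto
  also have "\<dots> = ?UV * ?m - ?V * ?U - ?U * ?V + ?UV * ?m"
    using int by simp
  finally have "bayes_inner M (log_class M u) (log_class M v)
      = 1 / (2 * ?m) * (?UV * ?m - ?V * ?U - ?U * ?V + ?UV * ?m)"
    by (subst bayes_inner_representatives[OF finite_measure_axioms _ _ exp_density(3) exp_density(3)])
       (auto intro: exp_density(4))
  also have "\<dots> = covar M u v"
    using m by (simp add: covar_def field_simps)
  finally show ?thesis .
qed

end

section \<open>Products of two finite measures\<close>

text \<open>
  The setting is symmetric in the two factors, and the locale can be instantiated with the factors
  exchanged. Facts about the second variable are obtained in this way from those about the first.
\<close>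

locale nonzero_finite_pair = L1: finite_measure L1 + L2: finite_measure L2
  for L1 :: "'a measure" and L2 :: "'b measure" +
  assumes pos1: "measure L1 (space L1) > 0" and pos2: "measure L2 (space L2) > 0"
begin

sublocale pair_sigma_finite L1 L2 ..

sublocale L: finite_measure "L1 \<Otimes>\<^sub>M L2"
  by (rule finite_measure_pair_measure) unfold_locales

abbreviation L where "L \<equiv> L1 \<Otimes>\<^sub>M L2"

lemma swapped: "nonzero_finite_pair L2 L1"
  by unfold_locales (rule pos1 pos2)+

lemma integrable_comp_fst:
  assumes "integrable L1 (f :: 'a \<Rightarrow> real)"
  shows "integrable L (\<lambda>z. f (fst z))"
  using assms by (intro Fubini_integrable) auto

lemma integral_comp_fst:
  assumes "integrable L1 (f :: 'a \<Rightarrow> real)"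
  shows "(\<integral>z. f (fst z) \<partial>L) = measure L2 (space L2) * (\<integral>x. f x \<partial>L1)"
  using integral_fst'[OF integrable_comp_fst[OF assms]] by simp

lemma integrable_comp_snd:
  assumes "integrable L2 (f :: 'b \<Rightarrow> real)"
  shows "integrable L (\<lambda>z. f (snd z))"
proof -
  interpret S: nonzero_finite_pair L2 L1 by (rule swapped)
  show ?thesis
    using S.integrable_product_swap[OF S.integrable_comp_fst[OF assms]]
    by (simp add: case_prod_beta')
qed

lemma measure_space_pair: "measure L (space L) = measure L1 (space L1) * measure L2 (space L2)"
  using integral_comp_fst[of "\<lambda>_. 1"] by simp

lemma pos: "measure L (space L) > 0"
  unfolding measure_space_pair using pos1 pos2 by simp

lemma sq_int_comp_fst: "sq_int L1 v \<Longrightarrow> sq_int L (\<lambda>z. v (fst z))"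
  using integrable_comp_fst[of "\<lambda>x. (v x)\<^sup>2"] by (auto simp: sq_int_def)

lemma sq_int_comp_snd: "sq_int L2 v \<Longrightarrow> sq_int L (\<lambda>z. v (snd z))"
  using integrable_comp_snd[of "\<lambda>x. (v x)\<^sup>2"] by (auto simp: sq_int_def)

lemma sq_int_sum: "sq_int L1 v1 \<Longrightarrow> sq_int L2 v2 \<Longrightarrow> sq_int L (\<lambda>z. v1 (fst z) + v2 (snd z))"
  by (intro sq_int_add sq_int_comp_fst sq_int_comp_snd)

lemma sq_int_swap:
  assumes "sq_int L u"
  shows "sq_int (L2 \<Otimes>\<^sub>M L1) (\<lambda>z. u (snd z, fst z))"
proof -
  have [measurable]: "u \<in> borel_measurable L" using assms by (simp add: sq_int_def)
  have "integrable (L2 \<Otimes>\<^sub>M L1) (\<lambda>z. (u (snd z, fst z))\<^sup>2)"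
    using integrable_product_swap[of "\<lambda>z. (u z)\<^sup>2"] assms
    by (simp add: sq_int_def case_prod_beta')
  thus ?thesis by (simp add: sq_int_def)
qed

lemma covar_swap:
  assumes "sq_int L u" "sq_int L v"
  shows "covar (L2 \<Otimes>\<^sub>M L1) (\<lambda>z. u (snd z, fst z)) (\<lambda>z. v (snd z, fst z)) = covar L u v"
proof -
  interpret S: nonzero_finite_pair L2 L1 by (rule swapped)
  have [measurable]: "u \<in> borel_measurable L" "v \<in> borel_measurable L"
    using assms by (simp_all add: sq_int_def)
  have "(\<integral>z. f (snd z, fst z) \<partial>(L2 \<Otimes>\<^sub>M L1)) = (\<integral>z. f z \<partial>L)"
    if "f \<in> borel_measurable L" for f :: "'a \<times> 'b \<Rightarrow> real"
    using integral_product_swap[OF that] by (simp add: case_prod_beta')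
  from this[of u] this[of v] this[of "\<lambda>z. u z * v z"] show ?thesis
    by (simp add: covar_def measure_space_pair S.measure_space_pair mult.commute)
qed

text \<open>
  By Fubini \<open>\<integral>p(x,y) v(x) = k \<integral>v\<close>, while \<open>\<integral>p = k L1(\<Omega>)\<close>: conditionally on the first
  variable \<open>p\<close> has a constant mean, and so it is uncorrelated with functions of that variable.
\<close>

lemma covar_comp_fst_eq_0:
  assumes p: "sq_int L p" and v: "sq_int L1 v"
    and k: "AE x in L1. (\<integral>y. p (x, y) \<partial>L2) = k"
  shows "covar L p (\<lambda>z. v (fst z)) = 0"
proof -
  have [measurable]: "p \<in> borel_measurable L" "v \<in> borel_measurable L1"
    using p v by (auto simp: sq_int_def)
  note int = L1.sq_int_integrable[OF v] L.sq_int_integrable[OF p]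
  have "(\<integral>z. p z * v (fst z) \<partial>L) = (\<integral>x. (\<integral>y. p (x, y) \<partial>L2) * v x \<partial>L1)"
    using integral_fst'[OF sq_int_integrable_mult[OF p sq_int_comp_fst[OF v]]] by simp
  also have "\<dots> = (\<integral>x. k * v x \<partial>L1)"
    by (rule integral_cong_AE) (use k in auto)
  finally have "(\<integral>z. p z * v (fst z) \<partial>L) = k * (\<integral>x. v x \<partial>L1)" by simp
  moreover have "(\<integral>z. p z \<partial>L) = (\<integral>x. k \<partial>L1)"
    unfolding integral_fst'[OF int(2), symmetric]
    by (rule integral_cong_AE) (use k in auto)
  ultimately show ?thesis
    using pos1 pos2 by (simp add: covar_def measure_space_pair integral_comp_fst[OF int(1)])
qed

end

section \<open>Geometric margins and independence in logarithmic coordinates\<close>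

text \<open>
  The logarithms of the geometric margins, as functions of the remaining variable.
\<close>

definition log_margin1 :: "'b measure \<Rightarrow> ('a \<times> 'b \<Rightarrow> real) \<Rightarrow> 'a \<Rightarrow> real" where
  "log_margin1 L2 u x = 1 / measure L2 (space L2) * (\<integral>y. u (x, y) \<partial>L2)"

definition log_margin2 :: "'a measure \<Rightarrow> ('a \<times> 'b \<Rightarrow> real) \<Rightarrow> 'b \<Rightarrow> real" where
  "log_margin2 L1 u y = 1 / measure L1 (space L1) * (\<integral>x. u (x, y) \<partial>L1)"

lemma log_margin2_eq_log_margin1_swap:
  "log_margin2 L1 u = log_margin1 L1 (\<lambda>z. u (snd z, fst z))"
  by (simp add: log_margin1_def log_margin2_def fun_eq_iff)

context nonzero_finite_pair
begin

text \<open>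
  The Jensen inequality on each section bounds the square of the average by the average of
  the squares, which is integrable by Fubini.
\<close>

lemma sq_int_log_margin1:
  assumes "sq_int L u"
  shows "sq_int L1 (log_margin1 L2 u)"
proof -
  have [measurable]: "u \<in> borel_measurable L" and int: "integrable L (\<lambda>z. (u z)\<^sup>2)"
    using assms by (auto simp: sq_int_def)
  have [measurable]: "log_margin1 L2 u \<in> borel_measurable L1"
    unfolding log_margin1_def by measurable
  have "integrable L1 (\<lambda>x. (log_margin1 L2 u x)\<^sup>2)"
  proof (rule Bochner_Integration.integrable_bound)
    show "integrable L1 (\<lambda>x. 1 / measure L2 (space L2) * (\<integral>y. (u (x, y))\<^sup>2 \<partial>L2))"
      by (intro integrable_mult_right integrable_fst'[OF int])
    show "AE x in L1. norm ((log_margin1 L2 u x)\<^sup>2)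
        \<le> norm (1 / measure L2 (space L2) * (\<integral>y. (u (x, y))\<^sup>2 \<partial>L2))"
      using AE_integrable_fst'[OF int] AE_space
    proof eventually_elim
      case (elim x)
      have "sq_int L2 (\<lambda>y. u (x, y))"
        using elim by (simp add: sq_int_def)
      from L2.square_integral_le[OF this pos2] show ?case
        by (simp add: log_margin1_def)
    qed
  qed measurable
  thus ?thesis by (simp add: sq_int_def)
qed

lemma sq_int_log_margin2: "sq_int L u \<Longrightarrow> sq_int L2 (log_margin2 L1 u)"
  unfolding log_margin2_eq_log_margin1_swap
  by (intro nonzero_finite_pair.sq_int_log_margin1[OF swapped] sq_int_swap)

text \<open>
  Integrating over \<open>y\<close>, the average of \<open>u(x,\<cdot>)\<close> cancels the integral of \<open>u(x,\<cdot>)\<close>, and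
  the section integral is the constant \<open>- \<integral>w\<close>. The function \<open>w\<close> is arbitrary so
  that the lemma applies with the other average in its place, also after exchanging the factors.
\<close>

lemma covar_minus_log_margin1_comp_fst:
  assumes u: "sq_int L u" and w: "sq_int L2 w" and v: "sq_int L1 v"
  shows "covar L (\<lambda>z. u z - (log_margin1 L2 u (fst z) + w (snd z))) (\<lambda>z. v (fst z)) = 0"
proof (rule covar_comp_fst_eq_0[OF _ v])
  show "sq_int L (\<lambda>z. u z - (log_margin1 L2 u (fst z) + w (snd z)))"
    by (intro sq_int_diff sq_int_sum u w sq_int_log_margin1)
  show "AE x in L1. (\<integral>y. u (x, y) - (log_margin1 L2 u (fst (x, y)) + w (snd (x, y))) \<partial>L2)
      = - (\<integral>y. w y \<partial>L2)"
    using AE_integrable_fst'[OF L.sq_int_integrable[OF u]]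
  proof eventually_elim
    case (elim x)
    thus ?case
      using L2.sq_int_integrable[OF w] pos2 by (simp add: log_margin1_def)
  qed
qed

lemma covar_minus_log_margins:
  assumes u: "sq_int L u" and v1: "sq_int L1 v1" and v2: "sq_int L2 v2"
  shows "covar L (\<lambda>z. u z - (log_margin1 L2 u (fst z) + log_margin2 L1 u (snd z)))
    (\<lambda>z. v1 (fst z) + v2 (snd z)) = 0"
proof -
  interpret S: nonzero_finite_pair L2 L1 by (rule swapped)
  let ?p = "\<lambda>z. u z - (log_margin1 L2 u (fst z) + log_margin2 L1 u (snd z))"
  have p: "sq_int L ?p"
    by (intro sq_int_diff sq_int_sum u sq_int_log_margin1 sq_int_log_margin2)
  have "covar L ?p (\<lambda>z. v2 (snd z)) =
      covar (L2 \<Otimes>\<^sub>M L1) (\<lambda>z. ?p (snd z, fst z)) (\<lambda>z. v2 (fst z))"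
    using covar_swap[OF p sq_int_comp_snd[OF v2]] by simp
  also have "\<dots> = 0"
    using S.covar_minus_log_margin1_comp_fst[OF sq_int_swap[OF u] sq_int_log_margin1[OF u] v2]
    by (simp add: log_margin2_eq_log_margin1_swap add.commute)
  finally have "covar L ?p (\<lambda>z. v2 (snd z)) = 0" .
  moreover have "covar L ?p (\<lambda>z. v1 (fst z)) = 0"
    by (rule covar_minus_log_margin1_comp_fst[OF u sq_int_log_margin2[OF u] v1])
  ultimately show ?thesis
    by (simp add: L.covar_add_right sq_int_comp_fst sq_int_comp_snd p v1 v2)
qed

lemma geo_margin1_log_class:
  assumes "sq_int L u"
  shows "geo_margin1 L1 L2 (log_class L u) = log_class L (\<lambda>z. log_margin1 L2 u (fst z))"
proof -
  have [measurable]: "u \<in> borel_measurable L" using assms by (simp add: sq_int_def)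
  let ?d = "dens L (log_class L u)"
  have "propto L (geo_mean1 L2 ?d) (geo_mean1 L2 (\<lambda>z. exp (u z)))"
    by (rule geo_mean1_propto[OF L1.finite_measure_axioms L2.finite_measure_axioms])
       (use L.sq_int_integrable[OF assms] L.dens_log_class[of u] L.exp_density(4)[of u]
         in \<open>auto intro: dens_pos L.finite_measure_axioms\<close>)
  moreover have "geo_mean1 L2 (\<lambda>z. exp (u z)) = (\<lambda>z. exp (log_margin1 L2 u (fst z)))"
    by (auto simp: geo_mean1_def log_margin1_def)
  ultimately have "propto L (geo_mean1 L2 ?d) (\<lambda>z. exp (log_margin1 L2 u (fst z)))"
    by simp
  moreover have "geo_mean1 L2 ?d \<in> borel_measurable L"
    unfolding geo_mean1_def by measurable
  moreover have "(\<lambda>z. exp (log_margin1 L2 u (fst z))) \<in> borel_measurable L"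
    unfolding log_margin1_def by measurable
  ultimately show ?thesis
    unfolding geo_margin1_def log_class_def[of _ "\<lambda>z. log_margin1 L2 u (fst z)"]
    by (subst bayes_class_eq_iff)
       (auto intro: L.finite_measure_axioms simp: geo_mean1_def split: prod.splits)
qed

lemma geo_margin2_log_class:
  assumes "sq_int L u"
  shows "geo_margin2 L1 L2 (log_class L u) = log_class L (\<lambda>z. log_margin2 L1 u (snd z))"
proof -
  have [measurable]: "u \<in> borel_measurable L" using assms by (simp add: sq_int_def)
  let ?d = "dens L (log_class L u)"
  have "propto L (geo_mean2 L1 ?d) (geo_mean2 L1 (\<lambda>z. exp (u z)))"
    by (rule geo_mean2_propto[OF L1.finite_measure_axioms L2.finite_measure_axioms])
       (use L.sq_int_integrable[OF assms] L.dens_log_class[of u] L.exp_density(4)[of u]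
         in \<open>auto intro: dens_pos L.finite_measure_axioms\<close>)
  moreover have "geo_mean2 L1 (\<lambda>z. exp (u z)) = (\<lambda>z. exp (log_margin2 L1 u (snd z)))"
    by (auto simp: geo_mean2_def log_margin2_def)
  ultimately have "propto L (geo_mean2 L1 ?d) (\<lambda>z. exp (log_margin2 L1 u (snd z)))"
    by simp
  moreover have "geo_mean2 L1 ?d \<in> borel_measurable L"
    unfolding geo_mean2_def by measurable
  moreover have "(\<lambda>z. exp (log_margin2 L1 u (snd z))) \<in> borel_measurable L"
    unfolding log_margin2_def by measurable
  ultimately show ?thesis
    unfolding geo_margin2_def log_class_def[of _ "\<lambda>z. log_margin2 L1 u (snd z)"]
    by (subst bayes_class_eq_iff)
       (auto intro: L.finite_measure_axioms simp: geo_mean2_def split: prod.splits)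
qed

lemma interaction_part_log_class:
  assumes "sq_int L u"
  shows "interaction_part L1 L2 (log_class L u) =
    log_class L (\<lambda>z. u z - (log_margin1 L2 u (fst z) + log_margin2 L1 u (snd z)))"
proof -
  have "u \<in> borel_measurable L"
    "(\<lambda>z. log_margin1 L2 u (fst z)) \<in> borel_measurable L"
    "(\<lambda>z. log_margin2 L1 u (snd z)) \<in> borel_measurable L"
    using assms sq_int_comp_fst[OF sq_int_log_margin1[OF assms]]
      sq_int_comp_snd[OF sq_int_log_margin2[OF assms]]
    by (simp_all add: sq_int_def)
  thus ?thesis
    by (simp add: interaction_part_def geo_margin1_log_class[OF assms]
        geo_margin2_log_class[OF assms] L.bayes_plus_log_class L.bayes_minus_log_class)
qed

lemma pair_measure_exp_density:
  assumes "sq_int L1 v1" "sq_int L2 v2"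
  shows "density L1 (\<lambda>x. ennreal (exp (v1 x))) \<Otimes>\<^sub>M density L2 (\<lambda>y. ennreal (exp (v2 y)))
    = density L (\<lambda>z. ennreal (exp (v1 (fst z) + v2 (snd z))))"
proof -
  have [measurable]: "v1 \<in> borel_measurable L1" "v2 \<in> borel_measurable L2"
    using assms by (auto simp: sq_int_def)
  have "sigma_finite_measure (density L2 (\<lambda>y. ennreal (exp (v2 y))))"
    using L2.exp_density(1)[of v2] by (simp add: bayes_measures_def)
  hence "density L1 (\<lambda>x. ennreal (exp (v1 x))) \<Otimes>\<^sub>M density L2 (\<lambda>y. ennreal (exp (v2 y)))
    = density L (\<lambda>(x, y). ennreal (exp (v1 x)) * ennreal (exp (v2 y)))"
    by (intro pair_measure_density) (auto intro: L2.sigma_finite_measure_axioms)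
  thus ?thesis
    by (simp add: exp_add ennreal_mult case_prod_beta')
qed

text \<open>
  The density of a product measure is the product of the densities, so the logarithms add up; and
  a single member, here the product measure, determines the class to which it belongs.
\<close>

lemma bayes_ind_eq:
  "bayes_ind L1 L2 =
    {log_class L (\<lambda>z. v1 (fst z) + v2 (snd z)) | v1 v2. sq_int L1 v1 \<and> sq_int L2 v2}"
proof (intro equalityI subsetI)
  fix G assume "G \<in> bayes_ind L1 L2"
  then obtain F1 F2 M1 M2 where G: "G \<in> bayes_L2 L" and "F1 \<in> bayes_L2 L1" "F2 \<in> bayes_L2 L2"
    "M1 \<in> F1" "M2 \<in> F2" and M: "M1 \<Otimes>\<^sub>M M2 \<in> G"
    unfolding bayes_ind_def by blast
  then obtain v1 v2 where v: "sq_int L1 v1" "sq_int L2 v2"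
    and "M1 = density L1 (\<lambda>x. ennreal (exp (v1 x)))" "M2 = density L2 (\<lambda>y. ennreal (exp (v2 y)))"
    using L1.bayes_L2_measure_eq_exp_density L2.bayes_L2_measure_eq_exp_density by blast
  with M have "density L (\<lambda>z. ennreal (exp (v1 (fst z) + v2 (snd z)))) \<in> G"
    by (simp add: pair_measure_exp_density)
  with G have "G = log_class L (\<lambda>z. v1 (fst z) + v2 (snd z))"
    by (intro L.eq_log_class) (auto simp: bayes_L2_def)
  with v show "G \<in> {log_class L (\<lambda>z. v1 (fst z) + v2 (snd z)) | v1 v2. sq_int L1 v1 \<and> sq_int L2 v2}"
    by blast
next
  fix G assume "G \<in> {log_class L (\<lambda>z. v1 (fst z) + v2 (snd z)) | v1 v2. sq_int L1 v1 \<and> sq_int L2 v2}"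
  then obtain v1 v2 where v: "sq_int L1 v1" "sq_int L2 v2"
    and G: "G = log_class L (\<lambda>z. v1 (fst z) + v2 (snd z))" by blast
  have "density L1 (\<lambda>x. ennreal (exp (v1 x))) \<in> log_class L1 v1"
    "density L2 (\<lambda>y. ennreal (exp (v2 y))) \<in> log_class L2 v2"
    using v by (auto intro!: L1.exp_density(3) L2.exp_density(3) simp: sq_int_def)
  moreover have "density L1 (\<lambda>x. ennreal (exp (v1 x))) \<Otimes>\<^sub>M density L2 (\<lambda>y. ennreal (exp (v2 y))) \<in> G"
    unfolding G pair_measure_exp_density[OF v]
    using sq_int_sum[OF v] by (intro L.exp_density(3)) (simp add: sq_int_def)
  ultimately show "G \<in> bayes_ind L1 L2"
    unfolding bayes_ind_def
    using L.log_class_in_bayes_L2[OF sq_int_sum[OF v]] L1.log_class_in_bayes_L2[OF v(1)]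
      L2.log_class_in_bayes_L2[OF v(2)] G by blast
qed

lemma log_class_in_bayes_int_iff:
  assumes "sq_int L u"
  shows "log_class L u \<in> bayes_int L1 L2 \<longleftrightarrow>
    (\<forall>v1 v2. sq_int L1 v1 \<longrightarrow> sq_int L2 v2 \<longrightarrow> covar L u (\<lambda>z. v1 (fst z) + v2 (snd z)) = 0)"
proof -
  have "bayes_inner L (log_class L u) (log_class L (\<lambda>z. v1 (fst z) + v2 (snd z)))
      = covar L u (\<lambda>z. v1 (fst z) + v2 (snd z))" if "sq_int L1 v1" "sq_int L2 v2" for v1 v2
    by (rule L.bayes_inner_log_class[OF assms sq_int_sum[OF that] pos])
  thus ?thesis
    unfolding bayes_int_def bayes_ind_eq using L.log_class_in_bayes_L2[OF assms] by fastforce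
qed

section \<open>The orthogonal projection\<close>

text \<open>
  With \<open>h = p - q\<close> the difference of two projections, \<open>u - p\<close> and \<open>u - q\<close> are both
  orthogonal to \<open>h\<close>, as the class of \<open>h\<close> lies in the interaction space. Subtracting,
  \<open>h\<close> is orthogonal to itself.
\<close>

lemma orthogonal_projection_bayes_int_unique:
  assumes u: "sq_int L u"
    and P: "is_orthogonal_projection L (bayes_int L1 L2) (log_class L u) P"
    and Q: "is_orthogonal_projection L (bayes_int L1 L2) (log_class L u) Q"
  shows "P = Q"
proof -
  have "P \<in> bayes_L2 L" "Q \<in> bayes_L2 L"
    using P Q by (auto simp: is_orthogonal_projection_def bayes_int_def)
  then obtain p q where p: "sq_int L p" "P = log_class L p" and q: "sq_int L q" "Q = log_class L q"
    by (elim L.bayes_L2_eq_log_class)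
  note [measurable] = sq_int_measurable[OF u] sq_int_measurable[OF p(1)] sq_int_measurable[OF q(1)]
  let ?h = "\<lambda>z. p z - q z"
  note sq = sq_int_diff[OF p(1) q(1)] sq_int_diff[OF u p(1)] sq_int_diff[OF u q(1)]
  have "log_class L p \<in> bayes_int L1 L2" "log_class L q \<in> bayes_int L1 L2"
    using P Q p q by (auto simp: is_orthogonal_projection_def)
  hence "log_class L ?h \<in> bayes_int L1 L2"
    by (simp add: log_class_in_bayes_int_iff p q sq L.covar_diff_left sq_int_sum)
  hence "bayes_inner L (bayes_minus L (log_class L u) P) (log_class L ?h) = 0"
    "bayes_inner L (bayes_minus L (log_class L u) Q) (log_class L ?h) = 0"
    using P Q by (auto simp: is_orthogonal_projection_def)
  hence "covar L (\<lambda>z. u z - p z) ?h = 0" "covar L (\<lambda>z. u z - q z) ?h = 0"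
    by (simp_all add: p(2) q(2) L.bayes_minus_log_class L.bayes_inner_log_class sq pos)
  hence "covar L ?h ?h = 0"
    by (simp add: L.covar_diff_left p(1) q(1) u sq)
  then obtain k where "AE z in L. p z - q z = k"
    using L.covar_self_eq_0_imp_AE_const[OF sq(1) pos] by blast
  hence "AE z in L. p z = k + q z"
    by eventually_elim simp
  thus ?thesis
    unfolding p(2) q(2) by (intro L.log_class_cong) auto
qed

text \<open>
  The remainder \<open>p = u - i\<close> after subtracting the sum \<open>i\<close> of the averages is in the interaction
  space, and what the projection removes from \<open>u\<close> is \<open>i\<close>, an element of the independence space,
  to which the interaction space is orthogonal by definition.
\<close>

lemma interaction_part_orthogonal_projection:
  assumes u: "sq_int L u"
  shows "is_orthogonal_projection L (bayes_int L1 L2) (log_class L u)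
    (interaction_part L1 L2 (log_class L u))"
proof -
  let ?i = "\<lambda>z. log_margin1 L2 u (fst z) + log_margin2 L1 u (snd z)"
  let ?p = "\<lambda>z. u z - ?i z"
  note m = sq_int_log_margin1[OF u] sq_int_log_margin2[OF u]
  have i: "sq_int L ?i" by (rule sq_int_sum[OF m])
  have p: "sq_int L ?p" by (rule sq_int_diff[OF u i])
  have "bayes_minus L (log_class L u) (log_class L ?p) = log_class L (\<lambda>z. u z - ?p z)"
    using u p by (intro L.bayes_minus_log_class) (auto simp: sq_int_def)
  hence diff: "bayes_minus L (log_class L u) (log_class L ?p) = log_class L ?i"
    by simp
  have "bayes_inner L (log_class L ?i) H = 0" if H: "H \<in> bayes_int L1 L2" for H
  proof -
    have "H \<in> bayes_L2 L" using H by (simp add: bayes_int_def)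
    then obtain h where h: "sq_int L h" "H = log_class L h"
      by (rule L.bayes_L2_eq_log_class)
    have "covar L h ?i = 0"
      using H m unfolding h(2) log_class_in_bayes_int_iff[OF h(1)] by blast
    thus ?thesis
      by (simp add: h(2) L.bayes_inner_log_class[OF i h(1) pos] covar_commute)
  qed
  moreover have "log_class L ?p \<in> bayes_int L1 L2"
    unfolding log_class_in_bayes_int_iff[OF p] using covar_minus_log_margins[OF u] by blast
  ultimately show ?thesis
    unfolding is_orthogonal_projection_def interaction_part_log_class[OF u] diff by blast
qed

end

theorem corollary3p2:
  fixes L1 :: "'a measure" and L2 :: "'b measure"
  assumes "finite_measure L1" and "emeasure L1 (space L1) \<noteq> 0"
    and "finite_measure L2" and "emeasure L2 (space L2) \<noteq> 0"
    and "F \<in> bayes_L2 (L1 \<Otimes>\<^sub>M L2)"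
  shows "is_orthogonal_projection (L1 \<Otimes>\<^sub>M L2) (bayes_int L1 L2) F (interaction_part L1 L2 F) \<and>
    (\<forall>P. is_orthogonal_projection (L1 \<Otimes>\<^sub>M L2) (bayes_int L1 L2) F P \<longrightarrow>
           P = interaction_part L1 L2 F)"
proof -
  interpret L1: finite_measure L1 by fact
  interpret L2: finite_measure L2 by fact
  interpret nonzero_finite_pair L1 L2
    using assms(2,4)
    by unfold_locales (simp_all add: L1.emeasure_eq_measure L2.emeasure_eq_measure zero_less_measure_iff)
  obtain u where "sq_int L u" "F = log_class L u"
    using L.bayes_L2_eq_log_class[OF assms(5)] by blast
  thus ?thesis
    using interaction_part_orthogonal_projection orthogonal_projection_bayes_int_unique by blast
qed

end
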